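(* Let $S_{\alpha,h}^k,S_{\alpha,h}^{k-1}\in\mathcal C_h$, $\alpha=w,n$, satisfy $S_{w,h}^j+S_{n,h}^j=1$ ($j=k-1,k$) and $0<S_{\alpha,h}^k,S_{\alpha,h}^{k-1}<1$ at every cell center, and let the face mobilities $\check M_{w,2},\check M_{n,2}$ be well defined and positive on every interior face. Assume $\sigma_{wn}<\frac12(\sigma_w+\sigma_n)$. Then the second-order scheme has a unique solution $S_{\alpha,h}^{k+1}\in\mathcal C_h$, $\alpha=w,n$, with $0<S_{\alpha,h}^{k+1}<1$ at every cell center. Explicitly: there is exactly one pair $(S_{w,h}^{k+1},S_{n,h}^{k+1})\in\mathcal C_h\times\mathcal C_h$ with values in $(0,1)$ and $S_{n,h}^{k+1}=1-S_{w,h}^{k+1}$ for which there exist $\psi_w,\psi_n\in\mathcal C_h$ such that, at every cell center, $$-\nabla_h\cdot(\check M_{\alpha,2}\nabla_h\psi_\alpha)=\phi_h\,(S_{w,h}^{k+1}-S_{w,h}^k),\qquad \alpha=w,n,$$ $$\mu_{w,h}^{k+\frac12}-\mu_{n,h}^{k+\frac12}+\frac1{\Delta t}\psi_w+\frac1{\Delta t}\psi_n=0,$$ where $$\mu_{w,h}^{k+\frac12}=\sigma_w\big(\mathcal H(S_{w,h}^{k+1},S_{w,h}^k)-1\big)+\sigma_{wn}(1-S_{w,h}^{k+\frac12})+\Delta t\,(\ln S_{w,h}^{k+1}-\ln S_{w,h}^k),$$ $$\mu_{n,h}^{k+\frac12}=\sigma_n\big(\mathcal H(1-S_{w,h}^{k+1},1-S_{w,h}^k)-1\big)+\sigma_{wn}S_{w,h}^{k+\frac12}+\Delta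 t\,(\ln(1-S_{w,h}^{k+1})-\ln S_{n,h}^k).$$
   Context: Grid. $d\in\{2,3\}$; $\Omega=\prod_{l=1}^d[a_l,b_l]$ is divided uniformly into cubic cells of side $h$, with $N_l=(b_l-a_l)/h$ a positive integer. $\mathcal C_h$ is the space of real functions on the set of cell centers. For an interior face shared by two cells adjacent in direction $l$, $(\nabla_h c)$ on that face is $(c^+-c^-)/h$, where $c^\pm$ are the values of $c$ at the two adjacent cell centers ($+$ being the one with the larger $l$-th coordinate). For a real function $u$ on faces, $(\nabla_h\cdot u)$ at a cell is $\sum_{l=1}^d (u_{l,\text{upper}}-u_{l,\text{lower}})/h$, the sum over the two faces of the cell orthogonal to direction $l$. Homogeneous no-flow boundary condition: in $\nabla_h\cdot(M\nabla_h c)$ the flux $M\nabla_h c$ is taken to be $0$ on every boundary face. Parameters. $\Delta t>0$, $m>0$, $K>0$, $\eta_w,\eta_n>0$, $\sigma_w,\sigma_n,\sigma_{wn}>0$ are real constants; $\phi_h\in\mathcal C_h$ is time-independent with $0<\phi_h<1$. The injection/production rates are zero. Notation. $S_{\alpha,h}^{k+\frac12}=\frac12(S_{\alpha,h}^{k+1}+S_{\alpha,h}^k)$. For $x,a>0$, $\mathcal H(x,a)=\dfrac{x\ln x-a\ln a}{x-a}$ if $x\ne a$ and $\mathcal H(a,a)=\ln a+1$ (applied pointwise). Mobilities. $\tilde S_{\alpha,h}^{k+1}=\frac32S_{\alpha,h}^k-\frac12S_{\alpha,h}^{k-1}$. On each interior face let $A_\alpha$ be the arithmetic mean of the values of $K(\tilde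 S_{\alpha,h}^{k+1})^m/\eta_\alpha$ at the two adjacent cell centers. The face mobility is $\check M_{\alpha,2}=A_\alpha$, or, in the regularized variant of the scheme, $\check M_{\alpha,2}=(A_\alpha^2+\Delta t^6)^{1/2}$ (the latter being automatically positive whenever the powers are defined). The statement holds for either choice. The function $\psi_\alpha$ plays the role of $\mathcal L^{-1}_{\check M_{\alpha,2}}(S_{w,h}^{k+1}-S_{w,h}^k)$ with $\mathcal L_{\check M_{\alpha,2}}=(-\nabla_h\cdot\check M_{\alpha,2}\nabla_h)/\phi_h$. The pressure is recovered afterwards by $p_h^{k+\frac12}=-\mu_{w,h}^{k+\frac12}-\psi_w/\Delta t$. *)

theory Defs
  imports "HOL-Analysis.Analysis"
begin

text \<open>
  The box $\prod_l [a_l, b_l]$ in \<^typ>\<open>real^'d\<close> is divided into cubic cells of side \<open>h\<close>,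
  \<open>N l\<close> of them in direction \<open>l\<close>.  Cells are represented by their centers.
\<close>

definition cell_centers :: "real^'d \<Rightarrow> real \<Rightarrow> ('d \<Rightarrow> nat) \<Rightarrow> (real^'d) set" where
  "cell_centers a h N = {x. \<forall>l. \<exists>i<N l. x $ l = a $ l + (real i + 1/2) * h}"

text \<open>
  Functions on the finite set of cell centers are represented by total functions with a fixed
  value outside that set, so that equality is equality at all cell centers.
\<close>

definition cell_functions :: "real^'d \<Rightarrow> real \<Rightarrow> ('d \<Rightarrow> nat) \<Rightarrow> (real^'d \<Rightarrow> real) set" where
  "cell_functions a h N = extensional (cell_centers a h N)"

text \<open>
  A face is given by its normal direction \<open>l\<close> and its center \<open>y\<close>; the two cells that share an
  interior face have centers \<open>y - (h/2) e\<^sub>l\<close> and \<open>y + (h/2) e\<^sub>l\<close>.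
\<close>

definition half_step :: "real \<Rightarrow> 'd \<Rightarrow> real^'d" where
  "half_step h l = axis l (h / 2)"

definition interior_face :: "real^'d \<Rightarrow> real \<Rightarrow> ('d \<Rightarrow> nat) \<Rightarrow> 'd \<Rightarrow> real^'d \<Rightarrow> bool" where
  "interior_face a h N l y \<longleftrightarrow>
     y - half_step h l \<in> cell_centers a h N \<and> y + half_step h l \<in> cell_centers a h N"

definition grad_h :: "real \<Rightarrow> (real^'d \<Rightarrow> real) \<Rightarrow> 'd \<Rightarrow> real^'d \<Rightarrow> real" where
  "grad_h h c l y = (c (y + half_step h l) - c (y - half_step h l)) / h"

definition div_h :: "real \<Rightarrow> ('d::finite \<Rightarrow> real^'d \<Rightarrow> real) \<Rightarrow> real^'d \<Rightarrow> real" where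
  "div_h h u x = (\<Sum>l\<in>UNIV. (u l (x + half_step h l) - u l (x - half_step h l)) / h)"

text \<open>The flux $M \nabla_h c$ with the homogeneous no-flow boundary condition.\<close>

definition flux_h ::
  "real^'d \<Rightarrow> real \<Rightarrow> ('d \<Rightarrow> nat) \<Rightarrow> ('d \<Rightarrow> real^'d \<Rightarrow> real) \<Rightarrow> (real^'d \<Rightarrow> real) \<Rightarrow> 'd \<Rightarrow> real^'d \<Rightarrow> real"
where
  "flux_h a h N M c l y = (if interior_face a h N l y then M l y * grad_h h c l y else 0)"

definition \<H> :: "real \<Rightarrow> real \<Rightarrow> real" where
  "\<H> x a = (if x \<noteq> a then (x * ln x - a * ln a) / (x - a) else ln a + 1)"

text \<open>
  The extrapolated saturations in the mobilities can be negative.  The real power $x^m$ with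
  $m > 0$ is regarded as defined for $x \ge 0$ and, if \<open>m\<close> is an integer, also for $x < 0$.
  (\<^const>\<open>powr\<close> alone does not give the right value for a negative base.)
\<close>

definition power_defined :: "real \<Rightarrow> real \<Rightarrow> bool" where
  "power_defined x m \<longleftrightarrow> 0 \<le> x \<or> m \<in> \<int>"

definition real_power :: "real \<Rightarrow> real \<Rightarrow> real" where
  "real_power x m = (if 0 \<le> x then x powr m else x ^ nat \<lfloor>m\<rfloor>)"

text \<open>Here \<open>S\<close> and \<open>S'\<close> are the saturations of one phase at the levels $k$ and $k-1$.\<close>

definition extrapolated :: "(real^'d \<Rightarrow> real) \<Rightarrow> (real^'d \<Rightarrow> real) \<Rightarrow> real^'d \<Rightarrow> real" where
  "extrapolated S S' x = 3/2 * S x - 1/2 * S' x"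

definition mean_mobility ::
  "real \<Rightarrow> real \<Rightarrow> real \<Rightarrow> real \<Rightarrow> (real^'d \<Rightarrow> real) \<Rightarrow> (real^'d \<Rightarrow> real) \<Rightarrow> 'd \<Rightarrow> real^'d \<Rightarrow> real"
where
  "mean_mobility h K m \<eta> S S' l y =
     (K * real_power (extrapolated S S' (y - half_step h l)) m / \<eta> +
      K * real_power (extrapolated S S' (y + half_step h l)) m / \<eta>) / 2"

datatype mobility_variant = Plain | Regularized

fun face_mobility ::
  "mobility_variant \<Rightarrow> real \<Rightarrow> real \<Rightarrow> real \<Rightarrow> real \<Rightarrow> real \<Rightarrow>
   (real^'d \<Rightarrow> real) \<Rightarrow> (real^'d \<Rightarrow> real) \<Rightarrow> 'd \<Rightarrow> real^'d \<Rightarrow> real"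
where
  "face_mobility Plain h \<Delta>t K m \<eta> S S' l y = mean_mobility h K m \<eta> S S' l y"
| "face_mobility Regularized h \<Delta>t K m \<eta> S S' l y =
     sqrt ((mean_mobility h K m \<eta> S S' l y)\<^sup>2 + \<Delta>t ^ 6)"

definition mobility_well_defined ::
  "real \<Rightarrow> real \<Rightarrow> (real^'d \<Rightarrow> real) \<Rightarrow> (real^'d \<Rightarrow> real) \<Rightarrow> 'd \<Rightarrow> real^'d \<Rightarrow> bool"
where
  "mobility_well_defined h m S S' l y \<longleftrightarrow>
     power_defined (extrapolated S S' (y - half_step h l)) m \<and>
     power_defined (extrapolated S S' (y + half_step h l)) m"

text \<open>
  Chemical potentials at level $k + 1/2$ as functions of the values at one cell center: \<open>s1\<close> and
  \<open>s0\<close> are the wetting saturations at levels $k+1$ and $k$, \<open>n0\<close> the non-wetting one at level $k$.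
\<close>

definition mu_w :: "real \<Rightarrow> real \<Rightarrow> real \<Rightarrow> real \<Rightarrow> real \<Rightarrow> real" where
  "mu_w \<sigma>w \<sigma>wn \<Delta>t s1 s0 =
     \<sigma>w * (\<H> s1 s0 - 1) + \<sigma>wn * (1 - 1/2 * (s1 + s0)) + \<Delta>t * (ln s1 - ln s0)"

definition mu_n :: "real \<Rightarrow> real \<Rightarrow> real \<Rightarrow> real \<Rightarrow> real \<Rightarrow> real \<Rightarrow> real" where
  "mu_n \<sigma>n \<sigma>wn \<Delta>t s1 s0 n0 =
     \<sigma>n * (\<H> (1 - s1) (1 - s0) - 1) + \<sigma>wn * (1/2 * (s1 + s0)) + \<Delta>t * (ln (1 - s1) - ln n0)"

end

theory Submission
  imports Defs
begin

text \<open>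
  At each cell the difference of the chemical potentials is a strictly increasing bijection
  $g_x$ from $(0,1)$ onto the reals: $\mathcal H(x,a)$ is the mean of $\ln + 1$ over the segment
  from $a$ to $x$, so it has slope at least $1/2$ on $(0,1)$, which beats the decreasing terms in
  $\sigma_{wn}$, and the terms $\Delta t \ln$ blow up at the ends.  Uniqueness follows since the
  discrete elliptic operators are positive semidefinite.  For existence, solve the potential
  equation for the saturation, $S = g_x^{-1}(-(\psi_w + \psi_n)/\Delta t)$.  The two remaining
  equations are the Euler-Lagrange equations of an unconstrained convex functional of
  $(\psi_w, \psi_n)$, the sum of two Dirichlet energies and a primitive of a monotone function of
  $\psi_w + \psi_n$.  It is coercive up to adding opposite constants to $\psi_w$ and $\psi_n$,
  because the grid is connected and $0 < S^k < 1$.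
\<close>

section \<open>Convex potentials on the line\<close>

text \<open>By the mean value theorem a chord of \<open>F\<close> has slope \<open>f z\<close> at an
  intermediate point \<open>z\<close>, and monotonicity compares it with \<open>f v\<close>. This is
  convexity of \<open>F\<close> in tangent form.\<close>

lemma primitive_above_tangent:
  fixes F f :: "real \<Rightarrow> real"
  assumes der: "\<And>u. (F has_real_derivative f u) (at u)" and "mono f"
  shows "F v + f v * (u - v) \<le> F u"
proof (cases u v rule: linorder_cases)
  case less
  then obtain z where z: "u < z" "z < v" "F v - F u = (v - u) * f z"
    using MVT2[of u v F f] der by blast
  have "(v - u) * f z \<le> (v - u) * f v"
    using z less by (intro mult_left_mono monoD[OF \<open>mono f\<close>]) simp_all
  then show ?thesis using z by (simp add: algebra_simps)
next
  case greater
  then obtain z where z: "v < z" "z < u" "F u - F v = (u - v) * f z"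
    using MVT2[of v u F f] der by blast
  have "(u - v) * f v \<le> (u - v) * f z"
    using z greater by (intro mult_left_mono monoD[OF \<open>mono f\<close>]) simp_all
  then show ?thesis using z by (simp add: algebra_simps)
qed simp

text \<open>The primitive is normalized to vanish at a zero of \<open>f\<close>, where its tangent
  is horizontal; this gives nonnegativity. The tangents at \<alpha> and \<beta> have slopes of
  opposite sign and bound each sublevel set on both sides.\<close>

lemma coercive_primitive:
  fixes f :: "real \<Rightarrow> real"
  assumes "mono f" and cont: "continuous_on UNIV f" and neg: "f \<alpha> < 0" and pos: "0 < f \<beta>"
  obtains F where "\<And>u. (F has_real_derivative f u) (at u)" "\<And>u. 0 \<le> F u"
    "\<And>C. \<exists>R. \<forall>u. F u \<le> C \<longrightarrow> \<bar>u\<bar> \<le> R"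
proof -
  have "\<exists>G. \<forall>x. -\<infinity> < ereal x \<longrightarrow> ereal x < \<infinity> \<longrightarrow> (G has_vector_derivative f x) (at x)"
    using cont by (intro einterval_antiderivative) (auto simp: continuous_on_eq_continuous_at)
  then obtain G where G: "(G has_real_derivative f u) (at u)" for u
    by (auto simp: has_real_derivative_iff_has_vector_derivative)
  have "\<alpha> < \<beta>"
    using neg pos \<open>mono f\<close> by (meson less_le_not_le linorder_not_less monoD order_trans)
  then obtain u0 where u0: "f u0 = 0"
    using IVT'[of f \<alpha> 0 \<beta>] neg pos continuous_on_subset[OF cont] by fastforce
  define F where "F u = G u - G u0" for u
  have der: "(F has_real_derivative f u) (at u)" for u
    unfolding F_def using G by (auto intro!: derivative_eq_intros)
  note tangent = primitive_above_tangent[of F f, OF der \<open>mono f\<close>]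
  have nonneg: "0 \<le> F u" for u
    using tangent[of u0 u] u0 by (simp add: F_def)
  have "\<bar>u\<bar> \<le> max \<bar>\<beta> + C / f \<beta>\<bar> \<bar>\<alpha> + C / f \<alpha>\<bar>" if "F u \<le> C" for u C
  proof -
    have "f \<beta> * (u - \<beta>) \<le> C" "f \<alpha> * (u - \<alpha>) \<le> C"
      using tangent[of \<beta> u] tangent[of \<alpha> u] nonneg[of \<alpha>] nonneg[of \<beta>] that by linarith+
    then have "u \<le> \<beta> + C / f \<beta>" "\<alpha> + C / f \<alpha> \<le> u"
      using neg pos by (simp_all add: field_simps)
    then show ?thesis by linarith
  qed
  then have "\<exists>R. \<forall>u. F u \<le> C \<longrightarrow> \<bar>u\<bar> \<le> R" for C by blast
  with der nonneg show ?thesis by (rule that)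
qed

section \<open>Weighted graphs\<close>

text \<open>The sign makes the operator positive semidefinite for symmetric nonnegative weights; on
  the grid it is minus the discrete divergence of the flux.\<close>

definition graph_laplacian :: "'a set \<Rightarrow> ('a \<Rightarrow> 'a \<Rightarrow> real) \<Rightarrow> ('a \<Rightarrow> real) \<Rightarrow> 'a \<Rightarrow> real" where
  "graph_laplacian V w p x = (\<Sum>y\<in>V. w x y * (p x - p y))"

text \<open>The sum runs over ordered pairs, so each edge counts twice. Hence the factor 2 in
  \<open>dirichlet_form_eq\<close> and the quarters in the functional minimized below.\<close>

definition dirichlet_form ::
  "'a set \<Rightarrow> ('a \<Rightarrow> 'a \<Rightarrow> real) \<Rightarrow> ('a \<Rightarrow> real) \<Rightarrow> ('a \<Rightarrow> real) \<Rightarrow> real"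
where
  "dirichlet_form V w p q = (\<Sum>x\<in>V. \<Sum>y\<in>V. w x y * (p x - p y) * (q x - q y))"

lemma graph_laplacian_cong:
  "(\<And>y. y \<in> V \<Longrightarrow> p y = q y) \<Longrightarrow> x \<in> V \<Longrightarrow> graph_laplacian V w p x = graph_laplacian V w q x"
  unfolding graph_laplacian_def by (intro sum.cong) auto

lemma graph_laplacian_diff:
  "graph_laplacian V w (\<lambda>x. p x - q x) x = graph_laplacian V w p x - graph_laplacian V w q x"
  unfolding graph_laplacian_def by (simp add: sum_subtractf[symmetric] algebra_simps)

locale weighted_graph =
  fixes V :: "'a set" and w :: "'a \<Rightarrow> 'a \<Rightarrow> real"
  assumes fin: "finite V"
    and sym: "x \<in> V \<Longrightarrow> y \<in> V \<Longrightarrow> w x y = w y x"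
    and nonneg: "x \<in> V \<Longrightarrow> y \<in> V \<Longrightarrow> 0 \<le> w x y"
begin

text \<open>Summation by parts: exchanging the two indices and using symmetry of \<open>w\<close>
  turns the part with \<open>q y\<close> into minus the part with \<open>q x\<close>.\<close>

lemma dirichlet_form_eq: "dirichlet_form V w p q = 2 * (\<Sum>x\<in>V. q x * graph_laplacian V w p x)"
proof -
  have "(\<Sum>x\<in>V. \<Sum>y\<in>V. w x y * (p x - p y) * q y) = (\<Sum>y\<in>V. \<Sum>x\<in>V. w x y * (p x - p y) * q y)"
    by (rule sum.swap)
  also have "\<dots> = (\<Sum>y\<in>V. \<Sum>x\<in>V. - (w y x * (p y - p x) * q y))"
    by (intro sum.cong) (auto simp: sym algebra_simps)
  finally have "(\<Sum>x\<in>V. \<Sum>y\<in>V. w x y * (p x - p y) * q y)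
      = - (\<Sum>x\<in>V. \<Sum>y\<in>V. w x y * (p x - p y) * q x)"
    by (simp add: sum_negf)
  moreover have "dirichlet_form V w p q = (\<Sum>x\<in>V. \<Sum>y\<in>V. w x y * (p x - p y) * q x)
      - (\<Sum>x\<in>V. \<Sum>y\<in>V. w x y * (p x - p y) * q y)"
    unfolding dirichlet_form_def
    by (simp only: right_diff_distrib[of "w _ _ * (p _ - p _)"] sum_subtractf)
  ultimately show ?thesis
    by (simp add: graph_laplacian_def sum_distrib_left mult_ac)
qed

lemma dirichlet_form_nonneg: "0 \<le> dirichlet_form V w p p"
  unfolding dirichlet_form_def
  by (intro sum_nonneg) (auto simp: nonneg mult.assoc intro!: mult_nonneg_nonneg)

lemma dirichlet_form_ge:
  assumes "x \<in> V" "y \<in> V"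
  shows "w x y * (p x - p y)\<^sup>2 \<le> dirichlet_form V w p p"
proof -
  have "w x y * (p x - p y)\<^sup>2 \<le> (\<Sum>y\<in>V. w x y * (p x - p y) * (p x - p y))"
    using member_le_sum[of y V "\<lambda>y. w x y * (p x - p y) * (p x - p y)"] assms fin nonneg
    by (simp add: power2_eq_square mult.assoc)
  also have "\<dots> \<le> dirichlet_form V w p p"
    unfolding dirichlet_form_def
    using member_le_sum[of x V "\<lambda>x. \<Sum>y\<in>V. w x y * (p x - p y) * (p x - p y)"] assms fin nonneg
    by (simp add: sum_nonneg mult.assoc)
  finally show ?thesis .
qed

lemma dirichlet_form_has_derivative:
  "((\<lambda>t. dirichlet_form V w (\<lambda>x. p x + t * r x) (\<lambda>x. p x + t * r x))
      has_real_derivative 2 * dirichlet_form V w p r) (at 0)"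
  unfolding dirichlet_form_def sum_distrib_left
  by (intro DERIV_sum) (auto intro!: derivative_eq_intros simp: algebra_simps)

end

locale connected_weighted_graph = weighted_graph +
  assumes connected: "x \<in> V \<Longrightarrow> y \<in> V \<Longrightarrow> (x, y) \<in> {(x, y). x \<in> V \<and> y \<in> V \<and> 0 < w x y}\<^sup>*"
begin

text \<open>Across one edge the increment of \<open>p\<close> is at most
  \<open>sqrt (C / w y z)\<close>. These bounds add up along a path, independently of
  \<open>p\<close>, and a maximum over the finitely many pairs makes them uniform.\<close>

lemma dirichlet_form_bounds_oscillation:
  "\<exists>R. \<forall>p. dirichlet_form V w p p \<le> C \<longrightarrow> (\<forall>x\<in>V. \<forall>y\<in>V. \<bar>p x - p y\<bar> \<le> R)"
proof -
  have "\<exists>R. \<forall>p. dirichlet_form V w p p \<le> C \<longrightarrow> \<bar>p x - p y\<bar> \<le> R" if "x \<in> V" "y \<in> V" for x y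
    using connected[OF that]
  proof induction
    case base
    show ?case by (rule exI[of _ 0]) simp
  next
    case (step y z)
    then obtain R where R: "dirichlet_form V w p p \<le> C \<Longrightarrow> \<bar>p x - p y\<bar> \<le> R" for p by blast
    have "\<bar>p x - p z\<bar> \<le> R + sqrt (C / w y z)" if "dirichlet_form V w p p \<le> C" for p
    proof -
      have "w y z * (p y - p z)\<^sup>2 \<le> C"
        using dirichlet_form_ge[of y z p] step.hyps that by auto
      then have "(p y - p z)\<^sup>2 \<le> C / w y z"
        using step.hyps by (simp add: field_simps)
      then have "\<bar>p y - p z\<bar> \<le> sqrt (C / w y z)"
        using real_sqrt_le_mono by fastforce
      then show ?thesis using R[OF that] by linarith
    qed
    then show ?case by blast
  qed
  then obtain R where R: "dirichlet_form V w p p \<le> C \<Longrightarrow> \<bar>p x - p y\<bar> \<le> R x y"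
    if "x \<in> V" "y \<in> V" for x y p
    by metis
  have "\<bar>p x - p y\<bar> \<le> Max ((\<lambda>(x, y). R x y) ` (V \<times> V))"
    if "dirichlet_form V w p p \<le> C" "x \<in> V" "y \<in> V" for p x y
  proof -
    have "R x y \<le> Max ((\<lambda>(x, y). R x y) ` (V \<times> V))"
      using that fin by (intro Max_ge) force+
    then show ?thesis using R[OF that(2,3,1)] by linarith
  qed
  then show ?thesis by blast
qed

end

section \<open>The coupled graph problem\<close>

lemma continuous_on_dirichlet_form:
  fixes P :: "'b::topological_space \<Rightarrow> 'a \<Rightarrow> real"
  assumes "\<And>x. continuous_on A (\<lambda>z. P z x)"
  shows "continuous_on A (\<lambda>z. dirichlet_form V w (P z) (P z))"
  unfolding dirichlet_form_def by (intro continuous_intros assms)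

text \<open>Direct method: \<open>D\<close> attains its minimum on a compact box, and every pair
  whose value does not exceed that of the zero functions can be moved into the box without changing
  \<open>D\<close>.\<close>

lemma minimum_ex:
  fixes V :: "'a set" and F :: "'a \<Rightarrow> real \<Rightarrow> real"
  assumes G1: "connected_weighted_graph V w1" and G2: "connected_weighted_graph V w2"
    and ne: "V \<noteq> {}"
    and cont: "\<And>x. x \<in> V \<Longrightarrow> continuous_on UNIV (F x)"
    and F_nonneg: "\<And>x u. x \<in> V \<Longrightarrow> 0 \<le> F x u"
    and coercive: "\<And>x C. x \<in> V \<Longrightarrow> \<exists>R. \<forall>u. F x u \<le> C \<longrightarrow> \<bar>u\<bar> \<le> R"
  defines "D \<equiv> \<lambda>p q. dirichlet_form V w1 p p / 4 + dirichlet_form V w2 q q / 4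
      + (\<Sum>x\<in>V. F x (p x + q x))"
  shows "\<exists>p q. \<forall>p' q'. D p q \<le> D p' q'"
proof -
  interpret G1: connected_weighted_graph V w1 by fact
  interpret G2: connected_weighted_graph V w2 by fact
  obtain x0 where x0: "x0 \<in> V" using ne by blast
  define C where "C = D (\<lambda>_. 0) (\<lambda>_. 0)"
  \<comment> \<open>All terms of \<open>D\<close> are nonnegative, so \<open>D \<le> C\<close>
    bounds each Dirichlet form by \<open>4 * C\<close>.\<close>
  obtain R1 where R1: "\<bar>p x - p y\<bar> \<le> R1"
    if "dirichlet_form V w1 p p \<le> 4 * C" "x \<in> V" "y \<in> V" for p x y
    using G1.dirichlet_form_bounds_oscillation by metis
  obtain R2 where R2: "\<bar>p x - p y\<bar> \<le> R2"
    if "dirichlet_form V w2 p p \<le> 4 * C" "x \<in> V" "y \<in> V" for p x y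
    using G2.dirichlet_form_bounds_oscillation by metis
  obtain R0 where R0: "F x0 u \<le> C \<Longrightarrow> \<bar>u\<bar> \<le> R0" for u
    using coercive[OF x0] by metis
  \<comment> \<open>After normalization \<open>q\<close> is bounded by \<open>R2\<close> and
    \<open>p\<close> by \<open>R0 + R1\<close>. The absolute values ensure that the zero functions
    lie in the box.\<close>
  define R where "R = \<bar>R0\<bar> + \<bar>R1\<bar> + \<bar>R2\<bar>"
  \<comment> \<open>Functions live on the whole type, so values off \<open>V\<close> are pinned to
    0; the box is then a product of compact sets and Tychonoff's theorem applies.\<close>
  define B where "B = (\<Pi>\<^sub>E x\<in>UNIV. if x \<in> V then {-R..R} else {0})"
  have "compactin (product_topology (\<lambda>_. euclidean) UNIV) B"
    unfolding B_def compactin_PiE by (auto simp: compactin_euclidean_iff)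
  then have "compact B"
    by (simp add: euclidean_product_topology compactin_euclidean_iff)
  then have "compact (B \<times> B)" by (simp add: compact_Times)
  have zero: "(\<lambda>_. 0, \<lambda>_. 0) \<in> B \<times> B" by (auto simp: B_def R_def)
  have coord: "continuous_on (B \<times> B) (\<lambda>z. fst z x)" "continuous_on (B \<times> B) (\<lambda>z. snd z x)"
    for x :: 'a
    by (rule continuous_on_product_then_coordinatewise; intro continuous_intros)+
  have "continuous_on (B \<times> B) (\<lambda>z. D (fst z) (snd z))"
    unfolding D_def
    by (intro continuous_intros continuous_on_dirichlet_form coord
        continuous_on_compose2[OF cont]) auto
  then obtain p q where "p \<in> B" "q \<in> B" and min: "\<And>p' q'. p' \<in> B \<Longrightarrow> q' \<in> B \<Longrightarrow> D p q \<le> D p' q'"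
    using continuous_attains_inf[OF \<open>compact (B \<times> B)\<close>, of "\<lambda>z. D (fst z) (snd z)"] zero
    by fastforce
  have "D p q \<le> D p' q'" for p' q'
  proof (cases "D p' q' \<le> C")
    case True
    \<comment> \<open>\<open>D\<close> does not change when opposite constants are added to the two functions, so the second one
      may be assumed to vanish at \<open>x0\<close>.\<close>
    define p'' where "p'' x = (if x \<in> V then p' x + q' x0 else 0)" for x
    define q'' where "q'' x = (if x \<in> V then q' x - q' x0 else 0)" for x
    have same: "D p'' q'' = D p' q'"
      unfolding D_def dirichlet_form_def by (simp add: p''_def q''_def)
    have sum_nonneg: "0 \<le> (\<Sum>x\<in>V. F x (p' x + q' x))"
      using F_nonneg by (intro sum_nonneg) auto
    have "F x0 (p' x0 + q' x0) \<le> (\<Sum>x\<in>V. F x (p' x + q' x))"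
      using member_le_sum[of x0 V "\<lambda>x. F x (p' x + q' x)"] x0 F_nonneg G1.fin by auto
    then have "F x0 (p' x0 + q' x0) \<le> C" "dirichlet_form V w1 p' p' \<le> 4 * C"
      "dirichlet_form V w2 q' q' \<le> 4 * C"
      using True sum_nonneg G1.dirichlet_form_nonneg[of p'] G2.dirichlet_form_nonneg[of q']
      unfolding D_def by linarith+
    then have *: "\<bar>p' x0 + q' x0\<bar> \<le> R0" "x \<in> V \<Longrightarrow> \<bar>p' x - p' x0\<bar> \<le> R1"
      "x \<in> V \<Longrightarrow> \<bar>q' x - q' x0\<bar> \<le> R2" for x
      using R0 R1 R2 x0 by blast+
    have "- R \<le> p'' x" "p'' x \<le> R" "- R \<le> q'' x" "q'' x \<le> R" if "x \<in> V" for x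
      using *(1) *(2,3)[OF that] that unfolding p''_def q''_def R_def
      by (simp_all add: abs_if split: if_splits)
    then have "p'' \<in> B" "q'' \<in> B"
      unfolding B_def by (auto simp: p''_def q''_def)
    then show ?thesis using min[of p'' q''] same by simp
  next
    case False
    then show ?thesis using min[of "\<lambda>_. 0" "\<lambda>_. 0"] zero by (auto simp: C_def)
  qed
  then show ?thesis by blast
qed

text \<open>Vary \<open>p\<close> at the single vertex \<open>x\<close>. The derivative of the
  functional along this variation vanishes at the minimum, and summation by parts identifies it with
  the left-hand side.\<close>

lemma stationary_point:
  fixes V :: "'a set" and F f :: "'a \<Rightarrow> real \<Rightarrow> real"
  assumes "weighted_graph V w" and x: "x \<in> V"
    and der: "\<And>y u. y \<in> V \<Longrightarrow> (F y has_real_derivative f y u) (at u)"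
    and min: "\<And>p'. dirichlet_form V w p p / 4 + (\<Sum>y\<in>V. F y (p y + q y))
        \<le> dirichlet_form V w p' p' / 4 + (\<Sum>y\<in>V. F y (p' y + q y))"
  shows "graph_laplacian V w p x + f x (p x + q x) = 0"
proof -
  interpret weighted_graph V w by fact
  define r :: "'a \<Rightarrow> real" where "r y = (if y = x then 1 else 0)" for y
  define J where "J t = dirichlet_form V w (\<lambda>y. p y + t * r y) (\<lambda>y. p y + t * r y) / 4
      + (\<Sum>y\<in>V. F y (p y + t * r y + q y))" for t
  have "((\<lambda>t. F y (p y + t * r y + q y)) has_real_derivative f y (p y + q y) * r y) (at 0)"
    if "y \<in> V" for y
    by (rule DERIV_chain2[where f = "F y"], simp add: der[OF that])
      (auto intro!: derivative_eq_intros)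
  then have "(J has_real_derivative 2 * dirichlet_form V w p r / 4
      + (\<Sum>y\<in>V. f y (p y + q y) * r y)) (at 0)"
    unfolding J_def
    by (intro DERIV_add DERIV_cdivide dirichlet_form_has_derivative DERIV_sum)
  moreover have "J 0 \<le> J t" for t
    using min[of "\<lambda>y. p y + t * r y"] by (simp add: J_def)
  ultimately have "2 * dirichlet_form V w p r / 4 + (\<Sum>y\<in>V. f y (p y + q y) * r y) = 0"
    by (intro DERIV_local_min[of J _ 0 1]) auto
  then have "(\<Sum>y\<in>V. r y * graph_laplacian V w p y) + (\<Sum>y\<in>V. f y (p y + q y) * r y) = 0"
    by (simp add: dirichlet_form_eq)
  moreover have "(\<Sum>y\<in>V. r y * k y) = k x" "(\<Sum>y\<in>V. k y * r y) = k x" for k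
    using x fin
    by (simp_all add: r_def if_distrib[of "\<lambda>c. c * _"] if_distrib[of "(*) _"] cong: if_cong)
  ultimately show ?thesis by metis
qed

text \<open>With \<open>F x\<close> a primitive of \<open>f x\<close>, these are the stationarity
  conditions in \<open>p\<close> and in \<open>q\<close> of the functional of
  \<open>minimum_ex\<close>. Both contain the same \<open>f\<close>, because \<open>F x\<close> is
  evaluated at the sum \<open>p x + q x\<close>.\<close>

lemma coupled_laplacian_ex:
  fixes V :: "'a set" and f :: "'a \<Rightarrow> real \<Rightarrow> real"
  assumes G1: "connected_weighted_graph V w1" and G2: "connected_weighted_graph V w2"
    and "V \<noteq> {}"
    and mono: "\<And>x. x \<in> V \<Longrightarrow> mono (f x)"
    and cont: "\<And>x. x \<in> V \<Longrightarrow> continuous_on UNIV (f x)"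
    and neg: "\<And>x. x \<in> V \<Longrightarrow> \<exists>u. f x u < 0" and pos: "\<And>x. x \<in> V \<Longrightarrow> \<exists>u. 0 < f x u"
  shows "\<exists>p q. \<forall>x\<in>V. graph_laplacian V w1 p x + f x (p x + q x) = 0 \<and>
      graph_laplacian V w2 q x + f x (p x + q x) = 0"
proof -
  interpret G1: connected_weighted_graph V w1 by fact
  interpret G2: connected_weighted_graph V w2 by fact
  have "\<exists>F. (\<forall>u. (F has_real_derivative f x u) (at u)) \<and> (\<forall>u. 0 \<le> F u) \<and>
      (\<forall>C. \<exists>R. \<forall>u. F u \<le> C \<longrightarrow> \<bar>u\<bar> \<le> R)" if "x \<in> V" for x
    using coercive_primitive[of "f x"] mono cont neg pos that by metis
  then obtain F where der: "\<And>x u. x \<in> V \<Longrightarrow> (F x has_real_derivative f x u) (at u)"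
    and F: "\<And>x u. x \<in> V \<Longrightarrow> 0 \<le> F x u"
      "\<And>x C. x \<in> V \<Longrightarrow> \<exists>R. \<forall>u. F x u \<le> C \<longrightarrow> \<bar>u\<bar> \<le> R"
    by metis
  have "continuous_on UNIV (F x)" if "x \<in> V" for x
    using der[OF that] by (meson DERIV_continuous_on has_field_derivative_at_within)
  then obtain p q where min: "dirichlet_form V w1 p p / 4 + dirichlet_form V w2 q q / 4
      + (\<Sum>x\<in>V. F x (p x + q x)) \<le> dirichlet_form V w1 p' p' / 4 + dirichlet_form V w2 q' q' / 4
      + (\<Sum>x\<in>V. F x (p' x + q' x))" for p' q'
    using minimum_ex[OF G1 G2 \<open>V \<noteq> {}\<close>, of F] F by blast
  have "graph_laplacian V w1 p x + f x (p x + q x) = 0" if "x \<in> V" for x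
    using min[of _ q]
    by (intro stationary_point[where F = F] that der G1.weighted_graph_axioms) simp_all
  moreover have "graph_laplacian V w2 q x + f x (q x + p x) = 0" if "x \<in> V" for x
    using min[of p]
    by (intro stationary_point[where F = F] that der G2.weighted_graph_axioms)
      (simp_all add: add.commute)
  ultimately show ?thesis by (auto simp: add.commute)
qed

text \<open>The last equation determines \<open>T\<close> from \<open>p + q\<close> through the
  inverse of \<open>g x\<close>; inserting it into the other two leaves a problem for
  \<open>p\<close> and \<open>q\<close> with a monotone nonlinearity.\<close>

lemma coupled_system_ex:
  fixes V :: "'a set" and g :: "'a \<Rightarrow> real \<Rightarrow> real"
  assumes G: "connected_weighted_graph V w1" "connected_weighted_graph V w2" "V \<noteq> {}"
    and "0 < \<Delta>t" and \<phi>: "\<And>x. x \<in> V \<Longrightarrow> 0 < \<phi> x"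
    and S: "\<And>x. x \<in> V \<Longrightarrow> 0 < S x \<and> S x < 1"
    and mono: "\<And>x. x \<in> V \<Longrightarrow> strict_mono_on {0<..<1} (g x)"
    and surj: "\<And>x. x \<in> V \<Longrightarrow> g x ` {0<..<1} = UNIV"
  shows "\<exists>T p q. \<forall>x\<in>V. 0 < T x \<and> T x < 1 \<and>
      graph_laplacian V w1 p x = \<phi> x * (T x - S x) \<and>
      graph_laplacian V w2 q x = \<phi> x * (T x - S x) \<and>
      g x (T x) + p x / \<Delta>t + q x / \<Delta>t = 0"
proof -
  define k where "k x = the_inv_into {0<..<1} (g x)" for x
  have inj: "inj_on (g x) {0<..<1}" if "x \<in> V" for x
    using mono[OF that] by (rule strict_mono_on_imp_inj_on)
  have k_range: "k x u \<in> {0<..<1}" and g_k: "g x (k x u) = u" if "x \<in> V" for x u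
    using the_inv_into_into[OF inj[OF that] _ subset_refl, of u]
      f_the_inv_into_f[OF inj[OF that], of u] unfolding k_def surj[OF that] by blast+
  have k_g: "k x (g x s) = s" if "x \<in> V" "s \<in> {0<..<1}" for x s
    using the_inv_into_f_f[OF inj] that by (auto simp: k_def)
  have k_mono: "k x u \<le> k x v" if "x \<in> V" "u \<le> v" for x u v
    using strict_mono_onD[OF mono[OF that(1)] k_range[OF that(1)] k_range[OF that(1)], of v u]
      g_k[OF that(1)] that(2) by fastforce
  have k_image: "range (k x) = {0<..<1}" if "x \<in> V" for x
    using k_range[OF that] k_g[OF that, symmetric] by blast
  \<comment> \<open>A monotone function with open range is continuous.\<close>
  have k_cont: "continuous_on A (k x)" if "x \<in> V" for x A
    by (rule continuous_on_subset[OF continuous_onI_mono[of "k x" UNIV]])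
      (auto simp: k_image k_mono that)
  \<comment> \<open>The minus signs before \<open>u\<close> and before \<open>k x\<close> cancel, so
    \<open>f x\<close> is increasing.\<close>
  define f where "f x u = \<phi> x * (S x - k x (- u / \<Delta>t))" for x u
  have "mono (f x)" if "x \<in> V" for x
    unfolding f_def using \<open>0 < \<Delta>t\<close> \<phi>[OF that]
    by (intro monoI mult_left_mono diff_left_mono k_mono that) (auto simp: divide_right_mono)
  moreover have "continuous_on UNIV (f x)" if "x \<in> V" for x
    unfolding f_def using \<open>0 < \<Delta>t\<close>
    by (intro continuous_intros continuous_on_compose2[OF k_cont[OF that]]) auto
  moreover have "\<exists>u. f x u < 0" "\<exists>u. 0 < f x u" if "x \<in> V" for x
  proof -
    have f_eq: "f x (- \<Delta>t * g x s) = \<phi> x * (S x - s)" if "s \<in> {0<..<1}" for s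
      using k_g[OF \<open>x \<in> V\<close> that] \<open>0 < \<Delta>t\<close> by (simp add: f_def)
    \<comment> \<open>The two arguments correspond to one saturation above \<open>S x\<close> and
      one below it, both inside the unit interval; this is where \<open>0 < S x < 1\<close>
      enters.\<close>
    have "f x (- \<Delta>t * g x ((S x + 1) / 2)) < 0" "0 < f x (- \<Delta>t * g x (S x / 2))"
      using S[OF that] \<phi>[OF that] by (subst f_eq; auto simp: mult_less_0_iff)+
    then show "\<exists>u. f x u < 0" "\<exists>u. 0 < f x u" by blast+
  qed
  ultimately obtain p q where pq: "\<And>x. x \<in> V \<Longrightarrow> graph_laplacian V w1 p x + f x (p x + q x) = 0"
      "\<And>x. x \<in> V \<Longrightarrow> graph_laplacian V w2 q x + f x (p x + q x) = 0"
    using coupled_laplacian_ex[OF G, of f] by blast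
  define T where "T x = k x (- (p x + q x) / \<Delta>t)" for x
  have "0 < T x \<and> T x < 1 \<and>
      graph_laplacian V w1 p x = \<phi> x * (T x - S x) \<and>
      graph_laplacian V w2 q x = \<phi> x * (T x - S x) \<and>
      g x (T x) + p x / \<Delta>t + q x / \<Delta>t = 0" if "x \<in> V" for x
    using k_range[OF that, of "- (p x + q x) / \<Delta>t"] g_k[OF that, of "- (p x + q x) / \<Delta>t"]
      pq[OF that] unfolding T_def f_def
    by (auto simp: algebra_simps add_divide_distrib diff_divide_distrib)
  then show ?thesis by blast
qed

text \<open>The differences of the two Laplace equations are tested with the differences of the
  potentials. The result is minus a sum of Dirichlet forms, while strict monotonicity of
  \<open>g\<close> makes it positive unless \<open>T\<close> and \<open>T'\<close> agree. The
  potentials themselves are not unique: opposite constants may be added to \<open>p\<close> and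
  \<open>q\<close>.\<close>

lemma coupled_system_unique:
  fixes V :: "'a set" and g :: "'a \<Rightarrow> real \<Rightarrow> real"
  assumes "weighted_graph V w1" "weighted_graph V w2"
    and "0 < \<Delta>t" and \<phi>: "\<And>x. x \<in> V \<Longrightarrow> 0 < \<phi> x"
    and mono: "\<And>x. x \<in> V \<Longrightarrow> strict_mono_on {0<..<1} (g x)"
    and sol: "\<And>x. x \<in> V \<Longrightarrow> 0 < T x \<and> T x < 1 \<and>
      graph_laplacian V w1 p x = \<phi> x * (T x - S x) \<and>
      graph_laplacian V w2 q x = \<phi> x * (T x - S x) \<and>
      g x (T x) + p x / \<Delta>t + q x / \<Delta>t = 0"
    and sol': "\<And>x. x \<in> V \<Longrightarrow> 0 < T' x \<and> T' x < 1 \<and>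
      graph_laplacian V w1 p' x = \<phi> x * (T' x - S x) \<and>
      graph_laplacian V w2 q' x = \<phi> x * (T' x - S x) \<and>
      g x (T' x) + p' x / \<Delta>t + q' x / \<Delta>t = 0"
    and "x \<in> V"
  shows "T x = T' x"
proof -
  interpret G1: weighted_graph V w1 by fact
  interpret G2: weighted_graph V w2 by fact
  define r where "r x = p x - p' x" for x
  define s where "s x = q x - q' x" for x
  define e where "e x = \<phi> x * (T x - T' x) * (g x (T x) - g x (T' x))" for x
  have pos: "0 < e y" if "y \<in> V" "T y \<noteq> T' y" for y
    using sol[OF that(1)] sol'[OF that(1)] \<phi>[OF that(1)] that(2)
      strict_mono_onD[OF mono[OF that(1)], of "T y" "T' y"]
      strict_mono_onD[OF mono[OF that(1)], of "T' y" "T y"]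
    unfolding e_def mult.assoc
    by (cases "T y < T' y") (auto intro!: mult_pos_pos[of "\<phi> y"] intro: mult_neg_neg)
  have e_eq: "e y = - (r y * graph_laplacian V w1 r y + s y * graph_laplacian V w2 s y) / \<Delta>t"
    if "y \<in> V" for y
  proof -
    have "graph_laplacian V w1 r y = \<phi> y * (T y - T' y)"
      "graph_laplacian V w2 s y = \<phi> y * (T y - T' y)"
      using sol[OF that] sol'[OF that] unfolding r_def s_def graph_laplacian_diff
      by (simp_all add: algebra_simps)
    moreover have "g y (T y) - g y (T' y) = - (r y + s y) / \<Delta>t"
      using sol[OF that] sol'[OF that] unfolding r_def s_def
      by (simp add: algebra_simps add_divide_distrib diff_divide_distrib)
    moreover have "c * (- (a + b) / d) = - (a * c + b * c) / d" for a b c d :: real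
      by (simp add: algebra_simps)
    ultimately show ?thesis
      unfolding e_def by (simp only:)
  qed
  have "sum e V = (\<Sum>y\<in>V. - (r y * graph_laplacian V w1 r y + s y * graph_laplacian V w2 s y) / \<Delta>t)"
    using e_eq by (rule sum.cong[OF refl])
  also have "\<dots> = - ((\<Sum>y\<in>V. r y * graph_laplacian V w1 r y)
      + (\<Sum>y\<in>V. s y * graph_laplacian V w2 s y)) / \<Delta>t"
    by (simp only: sum_divide_distrib[symmetric] sum_negf sum.distrib)
  also have "\<dots> = - (dirichlet_form V w1 r r + dirichlet_form V w2 s s) / (2 * \<Delta>t)"
    unfolding G1.dirichlet_form_eq G2.dirichlet_form_eq
    by (simp add: add_divide_distrib diff_divide_distrib)
  also have "\<dots> \<le> 0"
    using G1.dirichlet_form_nonneg[of r] G2.dirichlet_form_nonneg[of s] \<open>0 < \<Delta>t\<close>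
    by (intro divide_nonpos_pos) linarith+
  finally have "sum e V \<le> 0" .
  moreover have "0 \<le> e y" if "y \<in> V" for y
  proof (cases "T y = T' y")
    case False
    then show ?thesis using pos[OF that] by simp
  qed (simp add: e_def)
  then have "e x \<le> sum e V"
    using \<open>x \<in> V\<close> G1.fin by (intro member_le_sum) blast+
  ultimately show ?thesis using pos[OF \<open>x \<in> V\<close>] by linarith
qed

section \<open>The chemical potentials\<close>

text \<open>The function \<open>z * ln z\<close> has derivative \<open>ln z + 1\<close>, so its
  difference quotient is the mean of that derivative over the segment. For \<open>x = a\<close> the
  integrand is constant and gives the second branch of \<open>\<H>\<close>.\<close>

lemma \<H>_has_integral:
  assumes "0 < x" "0 < a"
  shows "((\<lambda>t. ln (a + t * (x - a)) + 1) has_integral \<H> x a) {0..1}"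
proof (cases "x = a")
  case True
  then show ?thesis
    using has_integral_const_real[of "ln a + 1" 0 1] by (simp add: \<H>_def)
next
  case False
  define F where "F t = (a + t * (x - a)) * ln (a + t * (x - a)) / (x - a)" for t
  have "(F has_vector_derivative ln (a + t * (x - a)) + 1) (at t within {0..1})"
    if "t \<in> {0..1}" for t
  proof -
    \<comment> \<open>Strict positivity comes from \<open>a\<close> when \<open>t = 0\<close> and
      from \<open>x\<close> otherwise.\<close>
    have "0 < (1 - t) * a + t * x"
      using that assms by (cases "t = 0") (auto intro!: add_nonneg_pos mult_pos_pos)
    then have pos: "0 < a + t * (x - a)" by (simp add: algebra_simps)
    have "((\<lambda>z. z * ln z) has_real_derivative ln z + 1) (at z)" if "0 < z" for z :: real
      using that by (auto intro!: derivative_eq_intros)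
    moreover have "((\<lambda>t. a + t * (x - a)) has_real_derivative x - a) (at t within {0..1})"
      by (auto intro!: derivative_eq_intros)
    ultimately have "(F has_real_derivative
        (ln (a + t * (x - a)) + 1) * (x - a) / (x - a)) (at t within {0..1})"
      unfolding F_def using pos by (intro DERIV_cdivide DERIV_chain2)
    then show ?thesis
      using False by (simp add: has_real_derivative_iff_has_vector_derivative)
  qed
  then have "((\<lambda>t. ln (a + t * (x - a)) + 1) has_integral F 1 - F 0) {0..1}"
    by (intro fundamental_theorem_of_calculus) auto
  then show ?thesis
    using False by (simp add: F_def \<H>_def diff_divide_distrib)
qed

lemma ln_diff_ge_diff:
  assumes "0 < v" "v \<le> u" "u \<le> (1::real)"
  shows "u - v \<le> ln u - ln v"
proof -
  have "ln (v / u) \<le> v / u - 1"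
    using assms by (intro ln_le_minus_one) auto
  moreover have "u - v \<le> (u - v) / u"
    using assms mult_left_le[of u "u - v"] by (simp add: pos_le_divide_eq)
  ultimately show ?thesis
    using assms by (simp add: ln_div diff_divide_distrib)
qed

text \<open>At parameter \<open>t\<close> the point of the segment moves by
  \<open>t * (y - x)\<close>, and \<open>ln\<close> grows at least as much since its slope on (0,1]
  is at least 1. The factor 1/2 is the integral of \<open>t\<close> over [0,1].\<close>

lemma \<H>_diff_ge:
  assumes "0 < x" "x \<le> y" "y \<le> 1" "0 < a" "a \<le> 1"
  shows "(y - x) / 2 \<le> \<H> y a - \<H> x a"
proof -
  have "((\<lambda>t. t * (y - x)) has_integral 1\<^sup>2 / 2 * (y - x) - 0\<^sup>2 / 2 * (y - x)) {0..1}"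
    by (intro fundamental_theorem_of_calculus)
      (auto simp flip: has_real_derivative_iff_has_vector_derivative intro!: derivative_eq_intros)
  moreover have "((\<lambda>t. (ln (a + t * (y - a)) + 1) - (ln (a + t * (x - a)) + 1))
      has_integral \<H> y a - \<H> x a) {0..1}"
    using assms by (intro has_integral_diff \<H>_has_integral) auto
  moreover have "t * (y - x) \<le> (ln (a + t * (y - a)) + 1) - (ln (a + t * (x - a)) + 1)"
    if "t \<in> {0..1}" for t
  proof -
    have "0 < (1 - t) * a + t * x"
      using that assms by (cases "t = 0") (auto intro!: add_nonneg_pos mult_pos_pos)
    moreover have "t * x \<le> t * y" using that assms by (simp add: mult_left_mono)
    moreover have "(1 - t) * a + t * y \<le> 1"
      using that assms by (intro convex_bound_le) auto
    ultimately have "((1 - t) * a + t * y) - ((1 - t) * a + t * x)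
        \<le> ln ((1 - t) * a + t * y) - ln ((1 - t) * a + t * x)"
      by (intro ln_diff_ge_diff) auto
    then show ?thesis by (simp add: algebra_simps)
  qed
  ultimately have "1\<^sup>2 / 2 * (y - x) - 0\<^sup>2 / 2 * (y - x) \<le> \<H> y a - \<H> x a"
    by (rule has_integral_le)
  then show ?thesis by simp
qed

text \<open>At \<open>x = a\<close> the quotient tends to the derivative of \<open>z * ln z\<close>,
  which is the value assigned there.\<close>

lemma isCont_\<H>:
  assumes "0 < x" "0 < a"
  shows "isCont (\<lambda>x. \<H> x a) x"
proof (cases "x = a")
  case True
  have "((\<lambda>x. x * ln x) has_real_derivative ln a + 1) (at a)"
    using assms by (auto intro!: derivative_eq_intros)
  then have "((\<lambda>x. (x * ln x - a * ln a) / (x - a)) \<longlongrightarrow> \<H> a a) (at a)"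
    by (simp add: has_field_derivative_iff \<H>_def)
  then have "((\<lambda>x. \<H> x a) \<longlongrightarrow> \<H> a a) (at a)"
    by (rule Lim_transform_eventually) (auto simp: \<H>_def eventually_at_filter)
  then show ?thesis by (simp add: isCont_def True)
next
  case False
  have "isCont (\<lambda>x. (x * ln x - a * ln a) / (x - a)) x"
    using assms False by (intro continuous_intros) auto
  moreover have "\<forall>\<^sub>F y in nhds x. \<H> y a = (y * ln y - a * ln a) / (y - a)"
    using t1_space_nhds[OF False] by eventually_elim (simp add: \<H>_def)
  ultimately show ?thesis by (simp add: isCont_cong)
qed

text \<open>The old non-wetting saturation is replaced by \<open>1 - s0\<close>, as the saturations
  at level k sum to 1; the old level then enters through \<open>s0\<close> only.\<close>

definition capillary_gap :: "real \<Rightarrow> real \<Rightarrow> real \<Rightarrow> real \<Rightarrow> real \<Rightarrow> real \<Rightarrow> real" where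
  "capillary_gap \<sigma>w \<sigma>n \<sigma>wn \<Delta>t s0 s = mu_w \<sigma>w \<sigma>wn \<Delta>t s s0 - mu_n \<sigma>n \<sigma>wn \<Delta>t s s0 (1 - s0)"

text \<open>The two \<open>\<H>\<close> terms contribute slope at least
  \<open>(\<sigma>w + \<sigma>n) / 2\<close> and the \<sigma>wn terms slope
  \<open>- \<sigma>wn\<close>. By the assumption on the surface tensions the sum is nonnegative, so
  the logarithmic increments remain as a lower bound.\<close>

lemma capillary_gap_diff_ge:
  assumes "0 < \<sigma>w" "0 < \<sigma>n" "\<sigma>wn < 1/2 * (\<sigma>w + \<sigma>n)"
    and "0 < s0" "s0 < 1" "0 < x" "x \<le> y" "y < 1"
  shows "\<Delta>t * (ln y - ln x) + \<Delta>t * (ln (1 - x) - ln (1 - y))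
    \<le> capillary_gap \<sigma>w \<sigma>n \<sigma>wn \<Delta>t s0 y - capillary_gap \<sigma>w \<sigma>n \<sigma>wn \<Delta>t s0 x"
proof -
  have "y - x \<le> 2 * (\<H> y s0 - \<H> x s0)" "y - x \<le> 2 * (\<H> (1 - x) (1 - s0) - \<H> (1 - y) (1 - s0))"
    using \<H>_diff_ge[of x y s0] \<H>_diff_ge[of "1 - y" "1 - x" "1 - s0"] assms by auto
  then have "\<sigma>w * (y - x) \<le> \<sigma>w * (2 * (\<H> y s0 - \<H> x s0))"
    "\<sigma>n * (y - x) \<le> \<sigma>n * (2 * (\<H> (1 - x) (1 - s0) - \<H> (1 - y) (1 - s0)))"
    using assms by (simp_all only: mult_left_mono less_imp_le)
  moreover have "(2 * \<sigma>wn) * (y - x) \<le> (\<sigma>w + \<sigma>n) * (y - x)"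
    using assms by (intro mult_right_mono) auto
  ultimately show ?thesis
    unfolding capillary_gap_def mu_w_def mu_n_def by (simp add: algebra_simps)
qed

lemma strict_mono_on_capillary_gap:
  assumes "0 < \<sigma>w" "0 < \<sigma>n" "\<sigma>wn < 1/2 * (\<sigma>w + \<sigma>n)" "0 < \<Delta>t" "0 < s0" "s0 < 1"
  shows "strict_mono_on {0<..<1} (capillary_gap \<sigma>w \<sigma>n \<sigma>wn \<Delta>t s0)"
proof (rule strict_mono_onI)
  fix x y :: real
  assume *: "x \<in> {0<..<1}" "y \<in> {0<..<1}" "x < y"
  then have "0 < \<Delta>t * (ln y - ln x) + \<Delta>t * (ln (1 - x) - ln (1 - y))"
    using assms by (intro add_pos_pos mult_pos_pos) auto
  then show "capillary_gap \<sigma>w \<sigma>n \<sigma>wn \<Delta>t s0 x < capillary_gap \<sigma>w \<sigma>n \<sigma>wn \<Delta>t s0 y"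
    using capillary_gap_diff_ge[of \<sigma>w \<sigma>n \<sigma>wn s0 x y \<Delta>t] * assms by auto
qed

lemma surj_capillary_gap:
  assumes "0 < \<sigma>w" "0 < \<sigma>n" "\<sigma>wn < 1/2 * (\<sigma>w + \<sigma>n)" "0 < \<Delta>t" "0 < s0" "s0 < 1"
  shows "capillary_gap \<sigma>w \<sigma>n \<sigma>wn \<Delta>t s0 ` {0<..<1} = UNIV"
proof -
  let ?g = "capillary_gap \<sigma>w \<sigma>n \<sigma>wn \<Delta>t s0"
  note ge = capillary_gap_diff_ge[OF assms(1-3,5,6), where \<Delta>t = \<Delta>t]
  have "u \<in> ?g ` {0<..<1}" for u
  proof -
    \<comment> \<open>\<open>\<Delta>t * c\<close> is the distance from the value at
      \<open>s0\<close> to the target \<open>u\<close>. The points \<open>x\<close> and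
      \<open>y\<close> are such that \<open>ln s\<close> drops by \<open>c\<close> from
      \<open>s0\<close> to \<open>x\<close> and \<open>ln (1 - s)\<close> drops by \<open>c\<close>
      from \<open>s0\<close> to \<open>y\<close>, so the values there enclose
      \<open>u\<close>.\<close>
    define c where "c = \<bar>u - ?g s0\<bar> / \<Delta>t"
    have c: "0 \<le> c" "\<Delta>t * c = \<bar>u - ?g s0\<bar>" using \<open>0 < \<Delta>t\<close> by (auto simp: c_def)
    define x where "x = s0 * exp (- c)"
    define y where "y = 1 - (1 - s0) * exp (- c)"
    have x: "0 < x" "x \<le> s0" using assms c by (auto simp: x_def mult_le_cancel_left1)
    have "(1 - s0) * exp (- c) \<le> 1 - s0" using assms c by (intro mult_left_le) auto
    then have "s0 \<le> y" unfolding y_def by linarith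
    moreover have "y < 1" using assms by (simp add: y_def)
    ultimately have y: "s0 \<le> y" "y < 1" .
    have ln_x: "ln s0 - ln x = c" using assms by (simp add: x_def ln_mult)
    have ln_y: "ln (1 - s0) - ln (1 - y) = c" using assms by (simp add: y_def ln_mult)
    have "0 \<le> \<Delta>t * (ln (1 - x) - ln (1 - s0))" "0 \<le> \<Delta>t * (ln y - ln s0)"
      using assms x y by auto
    then have "?g x \<le> u" "u \<le> ?g y"
      using ge[OF x assms(6), unfolded ln_x] ge[OF assms(5) y, unfolded ln_y] c(2)
      by linarith+
    moreover have "isCont ?g z" if "x \<le> z" "z \<le> y" for z
    proof -
      have z: "0 < z" "z < 1" using that x y by auto
      have w: "isCont (\<lambda>s. \<H> s s0) z"
        using z assms by (intro isCont_\<H>) auto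
      have "isCont (\<lambda>s. \<H> s (1 - s0)) (1 - z)"
        using z assms by (intro isCont_\<H>) auto
      then have n: "isCont (\<lambda>s. \<H> (1 - s) (1 - s0)) z"
        by (rule isCont_o2[rotated]) (intro continuous_intros)
      show ?thesis
        unfolding capillary_gap_def[abs_def] mu_w_def mu_n_def
        using z by (intro continuous_intros w n) auto
    qed
    then have "continuous_on {x..y} ?g"
      by (intro continuous_at_imp_continuous_on) auto
    ultimately obtain z where "x \<le> z" "z \<le> y" "?g z = u"
      using IVT'[of ?g x u y] x y by auto
    then show ?thesis using x y by auto
  qed
  then show ?thesis by auto
qed

section \<open>The grid as a weighted graph\<close>

lemma half_step_add_half_step: "half_step h l + half_step h l = axis l h"
  by (simp add: half_step_def vec_eq_iff axis_def)

definition cell_center :: "real^'d \<Rightarrow> real \<Rightarrow> ('d \<Rightarrow> nat) \<Rightarrow> real^'d" where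
  "cell_center a h i = (\<chi> l. a $ l + (real (i l) + 1/2) * h)"

lemma cell_centers_eq: "cell_centers a h N = cell_center a h ` {i. \<forall>l. i l < N l}"
proof (intro equalityI subsetI)
  fix x assume "x \<in> cell_centers a h N"
  then obtain i where "\<And>l. i l < N l" "\<And>l. x $ l = a $ l + (real (i l) + 1/2) * h"
    unfolding cell_centers_def by (simp add: choice_iff) blast
  then show "x \<in> cell_center a h ` {i. \<forall>l. i l < N l}"
    by (intro image_eqI[of _ _ i]) (auto simp: cell_center_def vec_eq_iff)
qed (auto simp: cell_centers_def cell_center_def)

lemma finite_cell_centers: "finite (cell_centers (a :: real^'d) h N)"
proof -
  have "{i. \<forall>l. i l < N l} = (\<Pi>\<^sub>E l\<in>UNIV. {..<N l})" by auto
  then show ?thesis unfolding cell_centers_eq by (simp add: finite_PiE)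
qed

lemma cell_center_Suc: "cell_center a h (i(l := Suc (i l))) = cell_center a h i + axis l h"
  by (auto simp: cell_center_def vec_eq_iff axis_def algebra_simps)

text \<open>One factor \<open>1 / h\<close> comes from the gradient, one from the divergence.
  Boundary faces need no special case: the graph sums range over grid cells only, so the weight
  towards a missing neighbor never enters.\<close>

definition grid_weight ::
  "real \<Rightarrow> ('d::finite \<Rightarrow> real^'d \<Rightarrow> real) \<Rightarrow> real^'d \<Rightarrow> real^'d \<Rightarrow> real"
where
  "grid_weight h M x y = (\<Sum>l\<in>UNIV.
     (if y = x + axis l h then M l (x + half_step h l) / h\<^sup>2 else 0) +
     (if y = x - axis l h then M l (x - half_step h l) / h\<^sup>2 else 0))"

text \<open>If \<open>y\<close> is the upper neighbor of \<open>x\<close>, then \<open>x\<close> is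
  the lower neighbor of \<open>y\<close>, and both see the same face center.\<close>

lemma grid_weight_sym: "grid_weight h M x y = grid_weight h M y x"
proof -
  have "(if y = x + axis l h then M l (x + half_step h l) / h\<^sup>2 else 0)
      = (if x = y - axis l h then M l (y - half_step h l) / h\<^sup>2 else 0)" for x y :: "real^'a" and l
  proof (cases "y = x + axis l h")
    case True
    then have *: "x = y - axis l h" "x + half_step h l = y - half_step h l"
      by (simp_all flip: half_step_add_half_step)
    show ?thesis
      by (simp only: if_P[OF True] if_P[OF *(1)] *(2))
  qed auto
  then show ?thesis
    unfolding grid_weight_def by (simp add: add.commute)
qed

lemma interior_face_right:
  "x \<in> cell_centers a h N \<Longrightarrow>
    interior_face a h N l (x + half_step h l) \<longleftrightarrow> x + axis l h \<in> cell_centers a h N"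
  by (simp add: interior_face_def add.assoc half_step_add_half_step)

lemma interior_face_left:
  "x \<in> cell_centers a h N \<Longrightarrow>
    interior_face a h N l (x - half_step h l) \<longleftrightarrow> x - axis l h \<in> cell_centers a h N"
  by (simp add: interior_face_def diff_diff_eq half_step_add_half_step)

text \<open>After the sums are exchanged, each direction leaves at most the two neighbors of
  \<open>x\<close>. A neighbor outside the grid contributes nothing, exactly like the zero flux on a
  boundary face.\<close>

lemma div_flux_eq_graph_laplacian:
  assumes "x \<in> cell_centers a h N"
  shows "- div_h h (flux_h a h N M c) x =
    graph_laplacian (cell_centers a h N) (grid_weight h M) c x"
proof -
  let ?V = "cell_centers a h N"
  have "graph_laplacian ?V (grid_weight h M) c x = (\<Sum>y\<in>?V. \<Sum>l\<in>UNIV.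
     (if y = x + axis l h then M l (x + half_step h l) / h\<^sup>2 * (c x - c y) else 0) +
     (if y = x - axis l h then M l (x - half_step h l) / h\<^sup>2 * (c x - c y) else 0))"
    unfolding graph_laplacian_def grid_weight_def sum_distrib_right
    by (intro sum.cong refl) (simp add: distrib_right if_distrib[of "\<lambda>z. z * _"])
  also have "\<dots> = (\<Sum>l\<in>UNIV. \<Sum>y\<in>?V.
     (if y = x + axis l h then M l (x + half_step h l) / h\<^sup>2 * (c x - c y) else 0) +
     (if y = x - axis l h then M l (x - half_step h l) / h\<^sup>2 * (c x - c y) else 0))"
    by (rule sum.swap)
  also have "\<dots> = (\<Sum>l\<in>UNIV.
     (if x + axis l h \<in> ?V then M l (x + half_step h l) / h\<^sup>2 * (c x - c (x + axis l h)) else 0) +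
     (if x - axis l h \<in> ?V then M l (x - half_step h l) / h\<^sup>2 * (c x - c (x - axis l h)) else 0))"
    by (simp only: sum.distrib sum.delta[OF finite_cell_centers])
  also have "\<dots> = (\<Sum>l\<in>UNIV. - (flux_h a h N M c l (x + half_step h l) / h) +
      flux_h a h N M c l (x - half_step h l) / h)"
  proof (intro sum.cong refl arg_cong2[of _ _ _ _ "(+)"])
    fix l
    have flip: "- (m * (v - u) / h\<^sup>2) = m * (u - v) / h\<^sup>2" for m u v :: real
      by (simp add: right_diff_distrib diff_divide_distrib)
    show "(if x + axis l h \<in> ?V then M l (x + half_step h l) / h\<^sup>2 * (c x - c (x + axis l h)) else 0)
      = - (flux_h a h N M c l (x + half_step h l) / h)"
      by (simp add: flux_h_def grad_h_def interior_face_right[OF assms] add.assoc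
          half_step_add_half_step flip flip: power2_eq_square)
    show "(if x - axis l h \<in> ?V then M l (x - half_step h l) / h\<^sup>2 * (c x - c (x - axis l h)) else 0)
      = flux_h a h N M c l (x - half_step h l) / h"
      by (simp add: flux_h_def grad_h_def interior_face_left[OF assms] diff_diff_eq
          half_step_add_half_step power2_eq_square)
  qed
  finally show ?thesis
    by (simp add: div_h_def sum_negf sum.distrib sum_subtractf diff_divide_distrib)
qed

text \<open>Lowering one index at a time leads from any cell to the corner cell with all indices 0;
  symmetry of the edges then joins any two cells.\<close>

lemma connected_weighted_graph_grid:
  fixes a :: "real^'d"
  assumes "0 < h" and M: "\<And>l y. interior_face a h N l y \<Longrightarrow> 0 < M l y"
  shows "connected_weighted_graph (cell_centers a h N) (grid_weight h M)"
proof
  let ?V = "cell_centers a h N"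
  let ?E = "{(x, y). x \<in> ?V \<and> y \<in> ?V \<and> 0 < grid_weight h M x y}"
  have summand_nonneg: "0 \<le> (if y = x + axis l h then M l (x + half_step h l) / h\<^sup>2 else 0) +
      (if y = x - axis l h then M l (x - half_step h l) / h\<^sup>2 else 0)"
    if "x \<in> ?V" "y \<in> ?V" for x y l
    using that M[of l "x + half_step h l"] M[of l "x - half_step h l"]
    by (intro add_nonneg_nonneg)
      (auto simp: interior_face_right interior_face_left intro!: divide_nonneg_nonneg)
  show "finite ?V" by (rule finite_cell_centers)
  show "grid_weight h M x y = grid_weight h M y x" for x y by (rule grid_weight_sym)
  show "0 \<le> grid_weight h M x y" if "x \<in> ?V" "y \<in> ?V" for x y
    unfolding grid_weight_def by (intro sum_nonneg summand_nonneg that)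
  have edge: "(x, x + axis l h) \<in> ?E" if "x \<in> ?V" "x + axis l h \<in> ?V" for x l
  proof -
    \<comment> \<open>The upper neighbor is not also the lower one, so only the positive first term
      is present.\<close>
    have "axis l h \<noteq> - axis l h"
      using \<open>0 < h\<close> by (auto simp: vec_eq_iff axis_def)
    then have "0 < (if x + axis l h = x + axis l h then M l (x + half_step h l) / h\<^sup>2 else 0) +
        (if x + axis l h = x - axis l h then M l (x - half_step h l) / h\<^sup>2 else 0)"
      using that M[of l "x + half_step h l"] \<open>0 < h\<close> by (auto simp: interior_face_right)
    then have "0 < grid_weight h M x (x + axis l h)"
      unfolding grid_weight_def
      by (intro sum_pos2[of UNIV l] summand_nonneg that) auto
    then show ?thesis using that by simp
  qed
  have "sym ?E" by (auto intro!: symI simp: grid_weight_sym)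
  have "(cell_center a h (\<lambda>_. 0), cell_center a h i) \<in> ?E\<^sup>*" if "\<forall>l. i l < N l" for i
    using that
  proof (induction "sum i UNIV" arbitrary: i)
    case 0
    then have "i = (\<lambda>_. 0)" by auto
    then show ?case by simp
  next
    case (Suc n)
    then obtain l where "i l \<noteq> 0" by (metis sum.neutral nat.distinct(1))
    define j where "j = i(l := i l - 1)"
    have i: "i = j(l := Suc (j l))" using \<open>i l \<noteq> 0\<close> by (auto simp: j_def)
    have j: "\<forall>l. j l < N l" using Suc.prems by (auto simp: j_def less_imp_diff_less)
    have "sum i UNIV = Suc (sum j UNIV)"
      by (subst (1 2) sum.remove[of _ l]) (auto simp: i intro!: sum.cong)
    then have path: "(cell_center a h (\<lambda>_. 0), cell_center a h j) \<in> ?E\<^sup>*"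
      using Suc.hyps j by simp
    have "cell_center a h i = cell_center a h j + axis l h"
      by (subst i) (rule cell_center_Suc)
    moreover have "cell_center a h j \<in> ?V" "cell_center a h i \<in> ?V"
      unfolding cell_centers_eq using j Suc.prems by blast+
    ultimately have "(cell_center a h j, cell_center a h i) \<in> ?E"
      using edge[of "cell_center a h j" l] by simp
    with path show ?case by (rule rtrancl_into_rtrancl)
  qed
  then have from_corner: "(cell_center a h (\<lambda>_. 0), x) \<in> ?E\<^sup>*" if "x \<in> ?V" for x
    using that by (auto simp: cell_centers_eq)
  show "(x, y) \<in> ?E\<^sup>*" if "x \<in> ?V" "y \<in> ?V" for x y
    using from_corner[OF that(1)] from_corner[OF that(2)] sym_rtrancl[OF \<open>sym ?E\<close>]
    by (meson rtrancl_trans symD)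
qed

section \<open>From the graph problem to the discrete scheme\<close>

theorem theorem3p5:
  fixes a b :: "real^'d" and N :: "'d \<Rightarrow> nat"
    and h \<Delta>t m K \<eta>w \<eta>n \<sigma>w \<sigma>n \<sigma>wn :: real
    and \<phi> Sw Sw' Sn Sn' :: "real^'d \<Rightarrow> real"
    and v :: mobility_variant
  assumes dim: "CARD('d) \<in> {2, 3}"
    and grid: "h > 0" "\<And>l. N l \<ge> 1" "\<And>l. real (N l) = (b $ l - a $ l) / h"
    and params: "\<Delta>t > 0" "m > 0" "K > 0" "\<eta>w > 0" "\<eta>n > 0" "\<sigma>w > 0" "\<sigma>n > 0" "\<sigma>wn > 0"
    and porosity: "\<phi> \<in> cell_functions a h N"
      "\<And>x. x \<in> cell_centers a h N \<Longrightarrow> 0 < \<phi> x \<and> \<phi> x < 1"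
    and level_k: "Sw \<in> cell_functions a h N" "Sn \<in> cell_functions a h N"
      "\<And>x. x \<in> cell_centers a h N \<Longrightarrow>
         Sw x + Sn x = 1 \<and> 0 < Sw x \<and> Sw x < 1 \<and> 0 < Sn x \<and> Sn x < 1"
    and level_k_minus_1: "Sw' \<in> cell_functions a h N" "Sn' \<in> cell_functions a h N"
      "\<And>x. x \<in> cell_centers a h N \<Longrightarrow>
         Sw' x + Sn' x = 1 \<and> 0 < Sw' x \<and> Sw' x < 1 \<and> 0 < Sn' x \<and> Sn' x < 1"
    and mobility_w: "\<And>l y. interior_face a h N l y \<Longrightarrow>
         mobility_well_defined h m Sw Sw' l y \<and> face_mobility v h \<Delta>t K m \<eta>w Sw Sw' l y > 0"
    and mobility_n: "\<And>l y. interior_face a h N l y \<Longrightarrow>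
         mobility_well_defined h m Sn Sn' l y \<and> face_mobility v h \<Delta>t K m \<eta>n Sn Sn' l y > 0"
    and surface_tension: "\<sigma>wn < 1/2 * (\<sigma>w + \<sigma>n)"
  shows "\<exists>!T. T \<in> cell_functions a h N \<times> cell_functions a h N \<and>
    (case T of (Tw, Tn) \<Rightarrow>
      (\<forall>x\<in>cell_centers a h N. 0 < Tw x \<and> Tw x < 1 \<and> 0 < Tn x \<and> Tn x < 1 \<and> Tn x = 1 - Tw x) \<and>
      (\<exists>\<psi>w\<in>cell_functions a h N. \<exists>\<psi>n\<in>cell_functions a h N. \<forall>x\<in>cell_centers a h N.
         - div_h h (flux_h a h N (face_mobility v h \<Delta>t K m \<eta>w Sw Sw') \<psi>w) x = \<phi> x * (Tw x - Sw x) \<and>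
         - div_h h (flux_h a h N (face_mobility v h \<Delta>t K m \<eta>n Sn Sn') \<psi>n) x = \<phi> x * (Tw x - Sw x) \<and>
         mu_w \<sigma>w \<sigma>wn \<Delta>t (Tw x) (Sw x) - mu_n \<sigma>n \<sigma>wn \<Delta>t (Tw x) (Sw x) (Sn x)
           + 1 / \<Delta>t * \<psi>w x + 1 / \<Delta>t * \<psi>n x = 0))"
proof -
  let ?V = "cell_centers a h N"
  let ?Mw = "face_mobility v h \<Delta>t K m \<eta>w Sw Sw'"
  let ?Mn = "face_mobility v h \<Delta>t K m \<eta>n Sn Sn'"
  let ?g = "\<lambda>x. capillary_gap \<sigma>w \<sigma>n \<sigma>wn \<Delta>t (Sw x)"
  let ?sol = "\<lambda>T p q x. 0 < T x \<and> T x < 1 \<and>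
    graph_laplacian ?V (grid_weight h ?Mw) p x = \<phi> x * (T x - Sw x) \<and>
    graph_laplacian ?V (grid_weight h ?Mn) q x = \<phi> x * (T x - Sw x) \<and>
    ?g x (T x) + p x / \<Delta>t + q x / \<Delta>t = 0"
  let ?eqs = "\<lambda>T p q x. - div_h h (flux_h a h N ?Mw p) x = \<phi> x * (T x - Sw x) \<and>
    - div_h h (flux_h a h N ?Mn q) x = \<phi> x * (T x - Sw x) \<and>
    mu_w \<sigma>w \<sigma>wn \<Delta>t (T x) (Sw x) - mu_n \<sigma>n \<sigma>wn \<Delta>t (T x) (Sw x) (Sn x)
      + 1 / \<Delta>t * p x + 1 / \<Delta>t * q x = 0"
  have Sn: "Sn x = 1 - Sw x" if "x \<in> ?V" for x
    using level_k(3)[OF that] by linarith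
  have sol_iff: "?sol T p q x \<longleftrightarrow> 0 < T x \<and> T x < 1 \<and> ?eqs T p q x" if "x \<in> ?V" for T p q x
    using that by (simp add: div_flux_eq_graph_laplacian capillary_gap_def Sn)
  have Gw: "connected_weighted_graph ?V (grid_weight h ?Mw)"
    using grid(1) mobility_w by (intro connected_weighted_graph_grid) auto
  have Gn: "connected_weighted_graph ?V (grid_weight h ?Mn)"
    using grid(1) mobility_n by (intro connected_weighted_graph_grid) auto
  have "cell_center a h (\<lambda>_. 0) \<in> ?V"
    using grid(2) by (auto simp: cell_centers_eq Suc_le_eq)
  then have ne: "?V \<noteq> {}" by blast
  have mono: "strict_mono_on {0<..<1} (?g x)" and surj: "?g x ` {0<..<1} = UNIV"
    if "x \<in> ?V" for x
    using level_k(3)[OF that] params surface_tension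
    by (intro strict_mono_on_capillary_gap surj_capillary_gap; simp)+
  have porosity_pos: "0 < \<phi> x" if "x \<in> ?V" for x using porosity(2)[OF that] by simp
  have Sw: "0 < Sw x \<and> Sw x < 1" if "x \<in> ?V" for x using level_k(3)[OF that] by simp
  obtain T p q where sol: "?sol T p q x" if "x \<in> ?V" for x
    using coupled_system_ex[OF Gw Gn ne params(1), of \<phi> Sw ?g] porosity_pos Sw mono surj by blast
  \<comment> \<open>The graph solution is arbitrary off the grid. Truncating it makes it a cell
    function, and the Laplacians on the grid see only values at grid cells.\<close>
  have restrict: "?eqs (restrict T ?V) (restrict p ?V) (restrict q ?V) x" if "x \<in> ?V" for x
  proof -
    have "graph_laplacian ?V w (restrict c ?V) x = graph_laplacian ?V w c x" for w c
      using that by (intro graph_laplacian_cong) auto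
    then show ?thesis
      using sol[OF that] that sol_iff[OF that, of "restrict T ?V" "restrict p ?V" "restrict q ?V"]
      by simp
  qed
  have unique: "T' x = T x" if "\<forall>x\<in>?V. 0 < T' x \<and> T' x < 1" "\<forall>x\<in>?V. ?eqs T' p' q' x" "x \<in> ?V"
    for T' p' q' x
  proof (rule coupled_system_unique[where V = ?V and g = ?g and \<phi> = \<phi> and S = Sw and \<Delta>t = \<Delta>t
        and p = p' and q = q' and p' = p and q' = q and T = T' and T' = T])
    show "weighted_graph ?V (grid_weight h ?Mw)" "weighted_graph ?V (grid_weight h ?Mn)"
      using Gw Gn by (simp_all add: connected_weighted_graph_def)
    show "?sol T' p' q' y" if "y \<in> ?V" for y
      unfolding sol_iff[OF that] using that(1) \<open>\<forall>x\<in>?V. 0 < T' x \<and> T' x < 1\<close>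
        \<open>\<forall>x\<in>?V. ?eqs T' p' q' x\<close> by blast
    show "?sol T p q y" if "y \<in> ?V" for y using sol[OF that] .
    show "0 < \<Delta>t" "x \<in> ?V" by fact+
    show "0 < \<phi> y" if "y \<in> ?V" for y using porosity_pos[OF that] .
    show "strict_mono_on {0<..<1} (?g y)" if "y \<in> ?V" for y using mono[OF that] .
  qed
  show ?thesis
  proof (rule ex1I[of _ "(restrict T ?V, restrict (\<lambda>x. 1 - T x) ?V)"], goal_cases)
    case 1
    have "restrict p ?V \<in> cell_functions a h N" "restrict q ?V \<in> cell_functions a h N"
      by (auto simp: cell_functions_def)
    with restrict have "\<exists>\<psi>w\<in>cell_functions a h N. \<exists>\<psi>n\<in>cell_functions a h N.
        \<forall>x\<in>?V. ?eqs (restrict T ?V) \<psi>w \<psi>n x" by blast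
    moreover have "0 < T x \<and> T x < 1" if "x \<in> ?V" for x using sol[OF that] by blast
    ultimately show ?case by (auto simp: cell_functions_def)
  next
    case (2 T')
    obtain Tw Tn where T': "T' = (Tw, Tn)" by (cases T')
    have Tw: "\<forall>x\<in>?V. 0 < Tw x \<and> Tw x < 1" and Tn: "\<forall>x\<in>?V. Tn x = 1 - Tw x"
      and ext: "Tw \<in> extensional ?V" "Tn \<in> extensional ?V"
      using 2 by (auto simp: T' cell_functions_def)
    obtain p' q' where "\<forall>x\<in>?V. ?eqs Tw p' q' x"
      using 2 unfolding T' by (auto simp only: prod.case)
    with Tw have "Tw x = T x" if "x \<in> ?V" for x
      using unique that by blast
    \<comment> \<open>Agreement at the cell centers becomes equality of functions because both
      components are extensional.\<close>
    with Tn ext show ?case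
      unfolding T' by (auto intro!: extensionalityI[of _ ?V])
  qed
qed

end
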